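(* As $n\to\infty$, \[\operatorname{ldim}\big(Q_n^{1,\lfloor n/2\rfloor}\big) = \frac{n}{\log n} + O\!\left(\frac{n\log\log n}{(\log n)^2}\right).\]
   Context: All logarithms are base 2. For $0\le \ell<k\le n$, $Q_n^{\ell,k}$ denotes the poset $\big([n]^{(\ell)}\cup[n]^{(k)},\subseteq\big)$ consisting of all $\ell$-element and all $k$-element subsets of $[n]=\{1,\dots,n\}$, ordered by inclusion. For a poset $P=(X,\le)$, a partial linear extension is a linear order $L=(Y,\le_L)$ with $Y\subseteq X$ such that for all $x,y\in Y$, $x\le y$ implies $x\le_L y$. A local realiser of $P$ is a set $\mathcal{L}$ of partial linear extensions such that for every ordered pair $(x,y)\in X^2$ with $x\not\ge y$ there is $L\in\mathcal{L}$ containing both $x$ and $y$ with $x\le_L y$. The multiplicity $\mu_{\mathcal{L}}(x)$ is the number of members of $\mathcal{L}$ whose ground set contains $x$. The local dimension $\operatorname{ldim}(P)$ is the minimum over all local realisers $\mathcal{L}$ of $\max_{x\in X}\mu_{\mathcal{L}}(x)$. *)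

theory Defs
  imports Complex_Main "HOL-Library.Landau_Symbols"
begin

text \<open>
  A poset is given by its reflexive order relation \<open>P\<close>, with \<open>(x, y) \<in> P\<close> meaning
  \<open>x \<le> y\<close>; by reflexivity its ground set is \<^term>\<open>Field P\<close>.  The same convention
  applies to the linear orders on subsets of the ground set.
\<close>

definition partial_linear_extension :: "'a rel \<Rightarrow> 'a rel \<Rightarrow> bool" where
  "partial_linear_extension P L \<longleftrightarrow>
     Linear_order L \<and> Field L \<subseteq> Field P \<and>
     (\<forall>x\<in>Field L. \<forall>y\<in>Field L. (x, y) \<in> P \<longrightarrow> (x, y) \<in> L)"

definition local_realiser :: "'a rel \<Rightarrow> 'a rel set \<Rightarrow> bool" where
  "local_realiser P \<L> \<longleftrightarrow>
     (\<forall>L\<in>\<L>. partial_linear_extension P L) \<and>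
     (\<forall>x\<in>Field P. \<forall>y\<in>Field P. (y, x) \<notin> P \<longrightarrow>
        (\<exists>L\<in>\<L>. x \<in> Field L \<and> y \<in> Field L \<and> (x, y) \<in> L))"

definition multiplicity_in :: "'a rel set \<Rightarrow> 'a \<Rightarrow> nat" where
  "multiplicity_in \<L> x = card {L \<in> \<L>. x \<in> Field L}"

text \<open>
  Meaningful for finite nonempty posets only, where all local realisers are finite and at
  least one exists, so that the infimum in \<^typ>\<open>nat\<close> is a minimum.
\<close>

definition ldim :: "'a rel \<Rightarrow> nat" where
  "ldim P = (INF \<L>\<in>{\<L>. local_realiser P \<L>}. MAX x\<in>Field P. multiplicity_in \<L> x)"

definition layer :: "nat \<Rightarrow> nat \<Rightarrow> nat set set" where
  "layer n k = {A. A \<subseteq> {1..n} \<and> card A = k}"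

definition Q :: "nat \<Rightarrow> nat \<Rightarrow> nat \<Rightarrow> nat set rel" where
  "Q n l k = {(A, B). A \<in> layer n l \<union> layer n k \<and> B \<in> layer n l \<union> layer n k \<and> A \<subseteq> B}"

lemma Field_Q: "Field (Q n l k) = layer n l \<union> layer n k"
  by (auto simp: Q_def Field_def)

lemma Partial_order_Q: "Partial_order (Q n l k)"
  unfolding partial_order_on_def preorder_on_def Field_Q
  by (auto simp: Q_def refl_on_def trans_def antisym_def)

lemma finite_Field_Q: "finite (Field (Q n l k))"
  by (rule finite_subset[of _ "Pow {1..n}"]) (auto simp: Field_Q layer_def)

end

theory Submission
  imports Defs "HOL-Real_Asymp.Real_Asymp"
begin

text \<open>
  Lower bound: in a local realiser of multiplicity \<open>d\<close>, a \<open>k\<close>-set \<open>A\<close> is determined by recording,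
  for each of the at most \<open>d\<close> orders containing it, the least singleton above it.  There are at
  most \<open>n d\<close> pairs of an order and a singleton in it, so
  \<open>n choose k \<le> (\<Sum>j\<le>d. n d choose j) \<le> (e n)\<^sup>d\<close>.

  Upper bound: cut \<open>{1..n}\<close> into blocks of size \<open>b \<approx> log n - 2 log log n\<close>.  For each block \<open>B\<close> and
  each \<open>T \<subseteq> B\<close>, take one order in which the singletons of \<open>T\<close> lie above all \<open>k\<close>-sets \<open>A\<close> with
  \<open>B - A = T\<close>; two orders of the whole ground set deal with all the other pairs.  A \<open>k\<close>-set lies in
  about \<open>n / b\<close> orders and a singleton in at most \<open>2\<^sup>b + 2\<close>.
\<close>

section \<open>Local realisers of finite posets\<close>

text \<open>Each member is a relation on the finite ground set, so \<open>card\<close> in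
  \<open>multiplicity_in\<close> is a true count.\<close>

lemma finite_local_realiser:
  assumes "finite (Field P)" "local_realiser P \<L>"
  shows "finite \<L>"
proof (rule finite_subset)
  show "\<L> \<subseteq> Pow (Field P \<times> Field P)"
  proof (intro subsetI PowI)
    fix L p assume "L \<in> \<L>" "p \<in> L"
    then have "fst p \<in> Field L" "snd p \<in> Field L" "Field L \<subseteq> Field P"
      using assms(2) FieldI1[of "fst p" "snd p" L] FieldI2[of "fst p" "snd p" L]
      by (simp_all add: local_realiser_def partial_linear_extension_def)
    then show "p \<in> Field P \<times> Field P" by (auto simp: mem_Times_iff)
  qed
qed (use assms in auto)

lemma ldim_le:
  assumes "local_realiser P \<L>" "finite (Field P)" "Field P \<noteq> {}"
    and "\<And>x. x \<in> Field P \<Longrightarrow> multiplicity_in \<L> x \<le> m"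
  shows "ldim P \<le> m"
proof -
  have "ldim P \<le> (MAX x\<in>Field P. multiplicity_in \<L> x)"
    unfolding ldim_def by (rule cINF_lower) (use assms in auto)
  also have "\<dots> \<le> m"
    using assms by (subst Max_le_iff) auto
  finally show ?thesis .
qed

text \<open>A nonempty set of naturals attains its infimum; one given realiser ensures
  nonemptiness.\<close>

lemma ldim_attained:
  assumes "local_realiser P \<L>" "finite (Field P)"
  obtains \<M> where "local_realiser P \<M>"
    "\<And>x. x \<in> Field P \<Longrightarrow> multiplicity_in \<M> x \<le> ldim P"
proof -
  let ?f = "\<lambda>\<L>. MAX x\<in>Field P. multiplicity_in \<L> x"
  have "ldim P \<in> ?f ` {\<L>. local_realiser P \<L>}"
    unfolding ldim_def by (rule Inf_nat_def1) (use assms in auto)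
  then obtain \<M> where "local_realiser P \<M>" "ldim P = ?f \<M>" by auto
  then show ?thesis using assms(2) that by auto
qed

section \<open>Lower bound\<close>

lemma card_layer: "card (layer n k) = n choose k"
  unfolding layer_def using n_subsets[of "{1..n}" k] by simp

lemma card_subsets_card_le:
  assumes "finite W"
  shows "card {X. X \<subseteq> W \<and> card X \<le> d} = (\<Sum>j\<le>d. card W choose j)"
proof -
  have "{X. X \<subseteq> W \<and> card X \<le> d} = (\<Union>j\<le>d. {X. X \<subseteq> W \<and> card X = j})" by auto
  also have "card \<dots> = (\<Sum>j\<le>d. card {X. X \<subseteq> W \<and> card X = j})"
    by (rule card_UN_disjoint) (use assms in auto)
  finally show ?thesis using n_subsets[OF assms] by simp
qed

lemma Linear_order_has_least:
  assumes "Linear_order L" "finite X" "X \<noteq> {}" "X \<subseteq> Field L"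
  shows "\<exists>m\<in>X. \<forall>x\<in>X. (m, x) \<in> L"
  using assms(2-4)
proof (induction rule: finite_ne_induct)
  case (singleton x)
  then show ?case
    using assms(1) by (auto simp: order_on_defs refl_on_def)
next
  case (insert x F)
  then obtain m where m: "m \<in> F" "\<forall>y\<in>F. (m, y) \<in> L" by auto
  have refl: "(y, y) \<in> L" if "y \<in> Field L" for y
    using assms(1) that by (simp add: order_on_defs refl_on_def)
  have "total_on (Field L) L" using assms(1) by (simp add: order_on_defs)
  moreover have "x \<in> Field L" "m \<in> Field L" using insert.prems m(1) by auto
  ultimately have "(m, x) \<in> L \<or> (x, m) \<in> L" "(x, x) \<in> L"
    using refl by (metis total_on_def)+
  moreover have "trans L" using assms(1) by (auto simp: order_on_defs)
  ultimately show ?case using m by (auto dest: transD)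
qed

text \<open>The map \<open>f\<close> encodes \<open>k\<close>-sets injectively as sets of at most
  \<open>d\<close> elements of \<open>W\<close>, where \<open>card W \<le> n * d\<close>; the bound
  counts the possible codes.\<close>

lemma choose_le_sum_choose:
  assumes R: "local_realiser (Q n 1 k) \<L>" and k: "k \<ge> 2"
    and mult: "\<And>x. x \<in> Field (Q n 1 k) \<Longrightarrow> multiplicity_in \<L> x \<le> d"
  shows "n choose k \<le> (\<Sum>j\<le>d. (n * d) choose j)"
proof -
  have fin: "finite \<L>" using R finite_local_realiser finite_Field_Q by blast
  have lin: "Linear_order L" and ext: "\<And>x y. \<lbrakk>x \<in> Field L; y \<in> Field L; (x, y) \<in> Q n 1 k\<rbrakk> \<Longrightarrow> (x, y) \<in> L"
    and tr: "trans L" and an: "antisym L" if "L \<in> \<L>" for L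
    using R that by (auto simp: local_realiser_def partial_linear_extension_def order_on_defs)
  have single: "{i} \<in> layer n 1" if "i \<in> {1..n}" for i
    using that by (auto simp: layer_def)
  \<comment> \<open>Incidences of singletons with orders; summing multiplicities over the singletons
    bounds \<open>card W\<close>.\<close>
  define W where "W = (SIGMA i:{1..n}. {L\<in>\<L>. {i} \<in> Field L})"
  have finW: "finite W" unfolding W_def using fin by auto
  have "card W = (\<Sum>i\<in>{1..n}. multiplicity_in \<L> {i})"
    unfolding W_def multiplicity_in_def using fin by (subst card_SigmaI) auto
  also have "\<dots> \<le> (\<Sum>i\<in>{1..n}. d)"
    using mult single unfolding Field_Q by (intro sum_mono) blast
  finally have cardW: "card W \<le> n * d" by simp
  \<comment> \<open>For every order with some singleton above \<open>A\<close>, the code records the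
    least such singleton.\<close>
  define f where "f A = {(i, L) \<in> W. (A, {i}) \<in> L \<and>
    (\<forall>j\<in>{1..n}. (A, {j}) \<in> L \<longrightarrow> ({i}, {j}) \<in> L)}" for A
  have f_card: "card (f A) \<le> d" if A: "A \<in> layer n k" for A
  proof -
    \<comment> \<open>By antisymmetry each order has at most one least singleton above
      \<open>A\<close>, so it contributes at most one pair.\<close>
    have "inj_on snd (f A)"
      using an by (fastforce simp: inj_on_def f_def W_def antisym_def)
    then have "card (f A) = card (snd ` f A)" by (simp add: card_image)
    also have "\<dots> \<le> card {L\<in>\<L>. A \<in> Field L}"
      by (rule card_mono) (use fin in \<open>auto simp: f_def W_def FieldI1\<close>)
    also have "\<dots> \<le> d" using mult[of A] A by (simp add: Field_Q multiplicity_in_def)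
    finally show ?thesis .
  qed
  \<comment> \<open>The code determines the complement of \<open>A\<close>. For \<open>j\<close>
    outside \<open>A\<close> the realiser has an order with \<open>A\<close> below
    \<open>{j}\<close>, and there the recorded singleton is below \<open>{j}\<close>. Conversely,
    transitivity puts \<open>A\<close> below \<open>{j}\<close>; if \<open>j\<close> were in
    \<open>A\<close>, the extension property and antisymmetry would give \<open>A = {j}\<close>,
    against \<open>k \<ge> 2\<close>.\<close>
  have decode: "{1..n} - A = {j \<in> {1..n}. \<exists>(i, L)\<in>f A. ({i}, {j}) \<in> L}" if A: "A \<in> layer n k" for A
  proof (intro equalityI subsetI)
    fix j assume "j \<in> {1..n} - A"
    then have j: "j \<in> {1..n}" "({j}, A) \<notin> Q n 1 k" "{j} \<in> Field (Q n 1 k)" "A \<in> Field (Q n 1 k)"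
      using A single unfolding Field_Q by (auto simp: Q_def)
    then obtain L where L: "L \<in> \<L>" "A \<in> Field L" "(A, {j}) \<in> L"
      using R unfolding local_realiser_def by blast
    define X where "X = {{i} |i. i \<in> {1..n} \<and> (A, {i}) \<in> L}"
    have "\<exists>m\<in>X. \<forall>x\<in>X. (m, x) \<in> L"
      by (rule Linear_order_has_least[OF lin[OF L(1)]])
        (use L(3) j(1) in \<open>auto simp: X_def FieldI2\<close>)
    then obtain i where i: "i \<in> {1..n}" "(A, {i}) \<in> L"
      "\<forall>j\<in>{1..n}. (A, {j}) \<in> L \<longrightarrow> ({i}, {j}) \<in> L"
      unfolding X_def by auto
    have "(i, L) \<in> f A" using i L(1) by (auto simp: f_def W_def FieldI2)
    then show "j \<in> {j \<in> {1..n}. \<exists>(i, L)\<in>f A. ({i}, {j}) \<in> L}"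
      using i(3) \<open>(i, L) \<in> f A\<close> L(3) j(1) by blast
  next
    fix j assume "j \<in> {j \<in> {1..n}. \<exists>(i, L)\<in>f A. ({i}, {j}) \<in> L}"
    then obtain i L where j: "j \<in> {1..n}" "L \<in> \<L>" "(A, {i}) \<in> L" "({i}, {j}) \<in> L"
      by (auto simp: f_def W_def)
    have Aj: "(A, {j}) \<in> L" using tr[OF j(2)] j(3,4) by (auto dest: transD)
    have "j \<notin> A"
    proof
      assume "j \<in> A"
      then have "({j}, A) \<in> Q n 1 k" using A single[OF j(1)] by (auto simp: Q_def)
      then have "({j}, A) \<in> L" by (rule ext[OF j(2) FieldI2[OF Aj] FieldI1[OF Aj]])
      then have "A = {j}" using antisymD[OF an[OF j(2)] Aj] by simp
      then show False using A k by (simp add: layer_def)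
    qed
    then show "j \<in> {1..n} - A" using j by auto
  qed
  have "inj_on f (layer n k)"
  proof (rule inj_onI)
    fix A B assume AB: "A \<in> layer n k" "B \<in> layer n k" "f A = f B"
    then have "{1..n} - A = {1..n} - B" using decode by simp
    then show "A = B" using AB by (auto simp: layer_def)
  qed
  moreover have "f ` layer n k \<subseteq> {X. X \<subseteq> W \<and> card X \<le> d}"
    using f_card by (auto simp: f_def)
  moreover have "finite {X. X \<subseteq> W \<and> card X \<le> d}"
    using finW by (auto intro: finite_subset[of _ "Pow W"])
  ultimately have "card (layer n k) \<le> card {X. X \<subseteq> W \<and> card X \<le> d}"
    by (rule card_inj_on_le)
  also have "\<dots> = (\<Sum>j\<le>d. card W choose j)" using card_subsets_card_le[OF finW] .
  also have "\<dots> \<le> (\<Sum>j\<le>d. (n * d) choose j)"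
    by (intro sum_mono binomial_right_mono cardW)
  finally show ?thesis by (simp add: card_layer)
qed

text \<open>Weighting the terms by \<open>n ^ (d - j) \<ge> 1\<close> turns the truncated sum into
  part of the expansion of \<open>(1 + 1/n) ^ (n * d)\<close>, scaled by \<open>n ^ d\<close>; then
  \<open>1 + 1/n \<le> exp (1/n)\<close>.\<close>

lemma sum_choose_le_exp:
  assumes "n \<ge> 1"
  shows "real (\<Sum>j\<le>d. (n * d) choose j) \<le> (exp 1 * real n) ^ d"
proof (cases "d = 0")
  case False
  have "real (\<Sum>j\<le>d. (n * d) choose j) = (\<Sum>j\<le>d. real ((n * d) choose j))" by simp
  also have "\<dots> \<le> (\<Sum>j\<le>d. real ((n * d) choose j) * (1 / n) ^ j * real n ^ d)"
  proof (rule sum_mono)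
    fix j assume j: "j \<in> {..d}"
    have "(1 / real n) ^ j * real n ^ d = real n ^ (d - j)"
      using j assms by (simp add: power_divide power_diff)
    also have "\<dots> \<ge> 1" using assms by simp
    finally show "real ((n * d) choose j) \<le> real ((n * d) choose j) * (1 / n) ^ j * real n ^ d"
      by (simp add: mult.assoc mult_left_mono[of 1 _ "real ((n * d) choose j)", simplified])
  qed
  also have "\<dots> \<le> (\<Sum>j\<le>n * d. real ((n * d) choose j) * (1 / n) ^ j * real n ^ d)"
    using assms by (intro sum_mono2) auto
  also have "\<dots> = (1 / n + 1) ^ (n * d) * real n ^ d"
    by (simp add: binomial_ring sum_distrib_right)
  also have "\<dots> \<le> exp (1 / n) ^ (n * d) * real n ^ d"
    by (intro mult_right_mono power_mono) (auto simp: add.commute exp_ge_add_one_self)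
  also have "exp (1 / n) ^ (n * d) = exp (1::real) ^ d"
    using assms by (simp flip: exp_of_nat_mult)
  finally show ?thesis by (simp add: power_mult_distrib)
qed auto

text \<open>The central coefficient is the largest of the \<open>n + 1\<close> coefficients summing
  to \<open>2 ^ n\<close>.\<close>

lemma two_power_le_central_binomial: "2 ^ n \<le> (n + 1) * (n choose (n div 2))"
proof -
  have "2 ^ n = (\<Sum>j\<le>n. n choose j)" by (simp add: choose_row_sum)
  also have "\<dots> \<le> (\<Sum>j\<le>n. n choose (n div 2))" by (intro sum_mono binomial_maximum)
  finally show ?thesis by simp
qed

section \<open>Upper bound\<close>

text \<open>Integer keys allow a layer to be reversed by negation and moved past the other layer by
  a shift.\<close>

definition key_order :: "'a set \<Rightarrow> ('a \<Rightarrow> int) \<Rightarrow> 'a rel" where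
  "key_order X f = {(x, y). x \<in> X \<and> y \<in> X \<and> f x \<le> f y}"

lemma Field_key_order [simp]: "Field (key_order X f) = X"
  by (auto simp: key_order_def Field_def)

lemma Linear_order_key_order:
  assumes "inj_on f X"
  shows "Linear_order (key_order X f)"
  using assms unfolding order_on_defs Field_key_order
  by (auto simp: key_order_def refl_on_def trans_def antisym_def total_on_def inj_on_def)

text \<open>Block indices run from 0 to \<open>n div b\<close>, so a \<open>k\<close>-set meets at
  most \<open>n div b + 1\<close> block orders, a singleton at most \<open>2 ^ b\<close>;
  \<open>up\<close> and \<open>down\<close> add 2. The stated sum bounds both counts.\<close>

lemma local_realiser_blocks:
  assumes k: "k \<ge> 2" and b: "b \<ge> 1"
  obtains \<L> where "local_realiser (Q n 1 k) \<L>"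
    "\<And>x. x \<in> Field (Q n 1 k) \<Longrightarrow> multiplicity_in \<L> x \<le> n div b + 2 ^ b + 3"
proof -
  \<comment> \<open>An arbitrary numbering of the subsets with values in \<open>0..<N\<close>, so
    that a shift by \<open>N\<close> separates the layers.\<close>
  obtain e0 :: "nat set \<Rightarrow> nat" and N0 where e0: "e0 ` Pow {1..n} = {i. i < N0}" "inj_on e0 (Pow {1..n})"
    using finite_imp_inj_to_nat_seg[of "Pow {1..n}"] by auto
  define e N where "e = int \<circ> e0" and "N = int N0"
  have e: "0 \<le> e x" "e x < N" if "x \<subseteq> {1..n}" for x
    using e0(1) that by (auto simp: e_def N_def)
  have einj: "e x = e y \<longleftrightarrow> x = y" if "x \<subseteq> {1..n}" "y \<subseteq> {1..n}" for x y
    using e0(2) that by (auto simp: e_def inj_on_def)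
  define S where "S = layer n 1"
  define K where "K = layer n k"
  define B where "B j = {i\<in>{1..n}. i div b = j}" for j
  \<comment> \<open>Both \<open>up\<close> and \<open>down\<close> put all singletons below all
    \<open>k\<close>-sets, but they order each layer in opposite directions.\<close>
  define up where "up = key_order (S \<union> K) (\<lambda>x. if card x = 1 then e x else N + e x)"
  define down where "down = key_order (S \<union> K) (\<lambda>x. if card x = 1 then - e x - N else - e x)"
  \<comment> \<open>The \<open>k\<close>-sets included here avoid \<open>T\<close>, so none contains
    a singleton of this order, and all singletons may be placed on top.\<close>
  define blk where "blk j T = key_order ({{i} |i. i \<in> T} \<union> {A\<in>K. A \<inter> B j = B j - T})
      (\<lambda>x. if card x = 1 then N + e x else e x)" for j T
  define \<L> where "\<L> = {up, down} \<union> {blk j T |j T. j \<le> n div b \<and> T \<subseteq> B j}"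
  have F: "Field (Q n 1 k) = S \<union> K" by (simp add: Field_Q S_def K_def)
  have S: "x \<subseteq> {1..n}" "card x = 1" if "x \<in> S" for x
    using that by (auto simp: S_def layer_def)
  have K: "x \<subseteq> {1..n}" "card x = k" "finite x" if "x \<in> K" for x
    using that by (auto simp: K_def layer_def intro: finite_subset)
  have Qsub: "(x, y) \<in> Q n 1 k \<longleftrightarrow> x \<subseteq> y" if "x \<in> S \<union> K" "y \<in> S \<union> K" for x y
    using that by (auto simp: Q_def S_def K_def)
  \<comment> \<open>The only strict comparabilities are singleton below \<open>k\<close>-set, so
    \<open>extension\<close> needs to check just those.\<close>
  have sub_cases: "x = y \<or> (x \<in> S \<and> y \<in> K)" if "x \<in> S \<union> K" "y \<in> S \<union> K" "x \<subseteq> y" for x y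
  proof -
    have "finite y" using that by (auto simp: S_def K_def layer_def intro: finite_subset)
    then have "card x \<le> card y" "card x = card y \<Longrightarrow> x = y"
      using that(3) card_mono[of y x] card_subset_eq[of y x] by auto
    then show ?thesis using that S K k by fastforce
  qed
  have TS: "{i} \<in> S" if "T \<subseteq> B j" "i \<in> T" for i j T
    using that by (auto simp: S_def layer_def B_def)

  have inj: "inj_on (\<lambda>x. if card x = 1 then e x else N + e x) (S \<union> K)"
    "inj_on (\<lambda>x. if card x = 1 then - e x - N else - e x) (S \<union> K)"
    "inj_on (\<lambda>x. if card x = 1 then N + e x else e x) (S \<union> K)"
  proof -
    have "x \<subseteq> {1..n}" if "x \<in> S \<union> K" for x using that S(1) K(1) by blast
    then have "0 \<le> e x" "e x < N" "e x = e y \<Longrightarrow> x = y" if "x \<in> S \<union> K" "y \<in> S \<union> K" for x y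
      using that e einj by simp_all
    then show "inj_on (\<lambda>x. if card x = 1 then e x else N + e x) (S \<union> K)"
      "inj_on (\<lambda>x. if card x = 1 then - e x - N else - e x) (S \<union> K)"
      "inj_on (\<lambda>x. if card x = 1 then N + e x else e x) (S \<union> K)"
      by (intro inj_onI; smt (verit))+
  qed
  have extension: "partial_linear_extension (Q n 1 k) (key_order X f)"
    if X: "X \<subseteq> S \<union> K" and f: "inj_on f (S \<union> K)"
      and SK: "\<And>x y. \<lbrakk>x \<in> S; y \<in> K; x \<in> X; y \<in> X; x \<subseteq> y\<rbrakk> \<Longrightarrow> f x \<le> f y" for X f
    unfolding partial_linear_extension_def F Field_key_order
  proof (intro conjI ballI impI)
    show "linear_order_on X (key_order X f)"
      using Linear_order_key_order[OF inj_on_subset[OF f X]] by simp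
  next
    fix x y assume xy: "x \<in> X" "y \<in> X" "(x, y) \<in> Q n 1 k"
    then have "x \<subseteq> y" by (simp add: Q_def)
    then have "f x \<le> f y" using sub_cases[of x y] SK[of x y] xy X by fastforce
    then show "(x, y) \<in> key_order X f" using xy by (simp add: key_order_def)
  qed (use X in simp)

  have up: "partial_linear_extension (Q n 1 k) up"
    unfolding up_def
  proof (rule extension[OF order_refl inj(1)])
    fix x y assume "x \<in> S" "y \<in> K"
    then show "(if card x = 1 then e x else N + e x) \<le> (if card y = 1 then e y else N + e y)"
      using S[of x] K[of y] k e(2)[of x] e(1)[of y] by simp
  qed
  have down: "partial_linear_extension (Q n 1 k) down"
    unfolding down_def
  proof (rule extension[OF order_refl inj(2)])
    fix x y assume "x \<in> S" "y \<in> K"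
    then show "(if card x = 1 then - e x - N else - e x) \<le> (if card y = 1 then - e y - N else - e y)"
      using S[of x] K[of y] k e(1)[of x] e(2)[of y] by simp
  qed
  have blk: "partial_linear_extension (Q n 1 k) (blk j T)" if T: "T \<subseteq> B j" for j T
    unfolding blk_def
  proof (rule extension[OF _ inj(3)])
    let ?X = "{{i} |i. i \<in> T} \<union> {A\<in>K. A \<inter> B j = B j - T}"
    show "?X \<subseteq> S \<union> K" using TS[OF T] by auto
    fix x y assume "x \<in> S" "y \<in> K" "x \<in> ?X" "y \<in> ?X" "x \<subseteq> y"
    moreover from this have "x \<notin> K" "y \<notin> S" using S(2)[of x] K(2)[of x] S(2)[of y] K(2)[of y] k by auto
    ultimately obtain i where "x = {i}" "i \<in> T" "y \<inter> B j = B j - T"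
      using TS[OF T] by auto
    then show "(if card x = 1 then N + e x else e x) \<le> (if card y = 1 then N + e y else e y)"
      using T \<open>x \<subseteq> y\<close> by auto
  qed

  have real: "local_realiser (Q n 1 k) \<L>"
    unfolding local_realiser_def
  proof (intro conjI ballI impI)
    fix L assume "L \<in> \<L>"
    then show "partial_linear_extension (Q n 1 k) L"
      unfolding \<L>_def using up down blk by blast
  next
    fix x y assume "x \<in> Field (Q n 1 k)" "y \<in> Field (Q n 1 k)" and nle: "(y, x) \<notin> Q n 1 k"
    then have xy: "x \<in> S \<union> K" "y \<in> S \<union> K" "\<not> y \<subseteq> x" using F Qsub by auto
    have cardK: "card z \<noteq> 1" if "z \<in> K" for z using K(2)[OF that] k by simp
    have fields: "Field up = S \<union> K" "Field down = S \<union> K" by (simp_all add: up_def down_def)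
    \<comment> \<open>Pairs within a layer are covered by the two opposite directions, singleton
      before \<open>k\<close>-set by \<open>up\<close>. What remains is a \<open>k\<close>-set
      before a singleton it does not contain.\<close>
    have "(x, y) \<in> up \<or> (x, y) \<in> down" if "x \<in> S \<or> y \<in> K"
    proof -
      have "x \<in> S \<and> y \<in> S \<or> x \<in> S \<and> y \<in> K \<or> x \<in> K \<and> y \<in> K" using that xy by auto
      then show ?thesis
      proof (elim disjE)
        assume "x \<in> S \<and> y \<in> K"
        then have "e x \<le> N + e y" using e(1)[of y] e(2)[of x] S K by force
        then show ?thesis using \<open>x \<in> S \<and> y \<in> K\<close> cardK S by (auto simp: up_def key_order_def)
      qed (use cardK S in \<open>auto simp: up_def down_def key_order_def\<close>)
    qed
    moreover have "\<exists>L\<in>\<L>. x \<in> Field L \<and> y \<in> Field L \<and> (x, y) \<in> L" if "\<not> (x \<in> S \<or> y \<in> K)"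
    proof -
      have "x \<in> K" "y \<in> S" using that xy by auto
      moreover from this obtain i where "y = {i}" "i \<in> {1..n}"
        using S[of y] by (auto simp: card_1_singleton_iff)
      ultimately have i: "y = {i}" "i \<in> {1..n}" "i \<notin> x" using xy(3) by auto
      \<comment> \<open>In the block of \<open>i\<close> the right choice is
        \<open>T = B j - x\<close>: it contains \<open>i\<close>, and the trace of \<open>x\<close>
        on the block is its complement.\<close>
      define j where "j = i div b"
      have "i \<in> B j - x" using i by (auto simp: B_def j_def)
      moreover have "x \<inter> B j = B j - (B j - x)" by auto
      moreover have "e x \<le> N + e y"
        using e(2)[of x] e(1)[of y] S(1)[OF \<open>y \<in> S\<close>] K(1)[OF \<open>x \<in> K\<close>] by linarith
      ultimately have "(x, y) \<in> blk j (B j - x)"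
        using \<open>x \<in> K\<close> cardK[OF \<open>x \<in> K\<close>] i(1) unfolding blk_def key_order_def by auto
      then have "x \<in> Field (blk j (B j - x))" "y \<in> Field (blk j (B j - x))"
        by (rule FieldI1, rule FieldI2)
      moreover have "j \<le> n div b" using i(2) by (simp add: j_def div_le_mono)
      then have "blk j (B j - x) \<in> \<L>" unfolding \<L>_def by blast
      ultimately show ?thesis using \<open>(x, y) \<in> blk j (B j - x)\<close> by blast
    qed
    ultimately show "\<exists>L\<in>\<L>. x \<in> Field L \<and> y \<in> Field L \<and> (x, y) \<in> L"
      using xy(1,2) fields unfolding \<L>_def by blast
  qed

  have cardB: "card (B j) \<le> b" for j
  proof -
    have "i div b * b \<le> i \<and> i < i div b * b + b" for i
      using b dividend_less_div_times[of b i] by simp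
    then have "B j \<subseteq> {j * b..<j * b + b}" by (auto simp: B_def)
    from card_mono[OF _ this] show ?thesis by simp
  qed
  have card2: "card {up, down} \<le> 2"
    by (simp add: card_insert_if)
  have "multiplicity_in \<L> x \<le> n div b + 2 ^ b + 3" if x: "x \<in> S \<union> K" for x
  proof (cases "x \<in> S")
    case True
    then obtain i where i: "x = {i}" by (auto simp: S_def layer_def card_1_singleton_iff)
    have "x \<notin> K" using S(2)[OF True] K(2)[of x] k by auto
    \<comment> \<open>A singleton \<open>{i}\<close> occurs in \<open>blk j T\<close> only if
      \<open>i \<in> T\<close>, which forces \<open>j\<close> to be the block of
      \<open>i\<close>.\<close>
    let ?M = "blk (i div b) ` Pow (B (i div b))"
    have "{L\<in>\<L>. x \<in> Field L} \<subseteq> {up, down} \<union> ?M"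
    proof
      fix L assume L: "L \<in> {L\<in>\<L>. x \<in> Field L}"
      show "L \<in> {up, down} \<union> ?M"
      proof (cases "L \<in> {up, down}")
        case False
        then obtain j T where jT: "L = blk j T" "T \<subseteq> B j"
          using L unfolding \<L>_def by blast
        then have "i \<in> T" using L \<open>x \<notin> K\<close> by (simp add: blk_def i)
        then have "j = i div b" using jT(2) by (auto simp: B_def)
        then show ?thesis using jT by auto
      qed auto
    qed
    then have "multiplicity_in \<L> x \<le> card ({up, down} \<union> ?M)"
      unfolding multiplicity_in_def by (rule card_mono[rotated]) (auto simp: B_def)
    also have "\<dots> \<le> card {up, down} + card ?M" by (rule card_Un_le)
    also have "card ?M \<le> card (Pow (B (i div b)))" by (rule card_image_le) (auto simp: B_def)
    also have "\<dots> \<le> 2 ^ b" using cardB by (auto simp: card_Pow B_def)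
    finally show ?thesis using card2 by linarith
  next
    case False
    then have "x \<in> K" using x by auto
    \<comment> \<open>A \<open>k\<close>-set \<open>x\<close> occurs in \<open>blk j T\<close> only
      for \<open>T = B j - x\<close>, so at most once per block.\<close>
    let ?M = "(\<lambda>j. blk j (B j - x)) ` {..n div b}"
    have "{L\<in>\<L>. x \<in> Field L} \<subseteq> {up, down} \<union> ?M"
    proof
      fix L assume L: "L \<in> {L\<in>\<L>. x \<in> Field L}"
      show "L \<in> {up, down} \<union> ?M"
      proof (cases "L \<in> {up, down}")
        case False
        then obtain j T where jT: "L = blk j T" "j \<le> n div b" "T \<subseteq> B j"
          using L unfolding \<L>_def by blast
        then have "x \<inter> B j = B j - T"
          using L \<open>x \<notin> S\<close> TS[OF jT(3)] by (auto simp: blk_def)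
        then have "T = B j - x" using jT(3) by auto
        then show ?thesis using jT by auto
      qed auto
    qed
    then have "multiplicity_in \<L> x \<le> card ({up, down} \<union> ?M)"
      unfolding multiplicity_in_def by (rule card_mono[rotated]) auto
    also have "\<dots> \<le> card {up, down} + card ?M" by (rule card_Un_le)
    also have "card ?M \<le> card {..n div b}" by (rule card_image_le) auto
    finally show ?thesis using card2 by simp
  qed
  then show thesis using that real F by blast
qed

section \<open>Explicit bounds on the local dimension and their asymptotics\<close>

lemma ldim_upper:
  assumes "2 \<le> k" "k \<le> n" "1 \<le> b"
  shows "ldim (Q n 1 k) \<le> n div b + 2 ^ b + 3"
proof -
  have "{1} \<in> layer n 1" using assms by (auto simp: layer_def)
  then have "Field (Q n 1 k) \<noteq> {}" unfolding Field_Q by blast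
  then show ?thesis
    using local_realiser_blocks[of k b n] assms ldim_le[OF _ finite_Field_Q] by metis
qed

text \<open>Chaining the estimates gives \<open>2 ^ n \<le> (n + 1) * (exp 1 * n) ^ d\<close>;
  taking logarithms and solving for \<open>d\<close> yields the bound.\<close>

lemma ldim_lower:
  assumes "n \<ge> 4"
  shows "(real n - log 2 (real n + 1)) / (log 2 (real n) + log 2 (exp 1)) \<le> ldim (Q n 1 (n div 2))"
proof -
  define d where "d = ldim (Q n 1 (n div 2))"
  have k: "2 \<le> n div 2" using assms by simp
  \<comment> \<open>Blocks of size 1 serve only to show that some realiser exists, so that the
    minimum is attained.\<close>
  obtain \<L> where "local_realiser (Q n 1 (n div 2)) \<L>"
    "\<And>x. x \<in> Field (Q n 1 (n div 2)) \<Longrightarrow> multiplicity_in \<L> x \<le> d"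
    using local_realiser_blocks[OF k order_refl] ldim_attained[OF _ finite_Field_Q]
    unfolding d_def by metis
  from choose_le_sum_choose[OF this(1) k this(2)]
  have "real (n choose (n div 2)) \<le> real (\<Sum>j\<le>d. (n * d) choose j)"
    by (simp only: of_nat_le_iff)
  also have "\<dots> \<le> (exp 1 * real n) ^ d"
    using sum_choose_le_exp assms by simp
  finally have choose: "real (n choose (n div 2)) \<le> (exp 1 * real n) ^ d" .
  have "(2::real) ^ n = real (2 ^ n)" by simp
  also have "\<dots> \<le> real ((n + 1) * (n choose (n div 2)))"
    using two_power_le_central_binomial by (simp only: of_nat_le_iff)
  also have "\<dots> = (real n + 1) * real (n choose (n div 2))" by (simp add: algebra_simps)
  also have "\<dots> \<le> (real n + 1) * (exp 1 * real n) ^ d"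
    by (rule mult_left_mono) (use choose in auto)
  finally have "(2::real) ^ n \<le> (real n + 1) * (exp 1 * real n) ^ d" .
  then have "log 2 (2 ^ n) \<le> log 2 ((real n + 1) * (exp 1 * real n) ^ d)"
    using assms by (subst log_le_cancel_iff) auto
  also have "\<dots> = log 2 (real n + 1) + d * (log 2 (real n) + log 2 (exp 1))"
    using assms by (simp add: log_mult log_nat_power add.commute)
  finally have "real n - log 2 (real n + 1) \<le> d * (log 2 (real n) + log 2 (exp 1))"
    by (simp add: log_nat_power)
  moreover have "0 < log 2 (real n) + log 2 (exp 1)"
    using assms by (intro add_pos_pos) auto
  ultimately show ?thesis by (simp add: d_def divide_le_eq)
qed

text \<open>With \<open>b\<close> the floor of \<open>x = log n - 2 log log n\<close>, the term
  \<open>2 ^ b\<close> is at most \<open>n / (log n)^2\<close>, below the target error, while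
  \<open>n / b\<close> stays close to \<open>n / log n\<close>. The \<open>- 1\<close> in the
  denominator pays for the floor.\<close>

lemma ldim_upper_log:
  assumes "n \<ge> 4" and pos: "log 2 (real n) - 2 * log 2 (log 2 (real n)) - 1 > 0"
  shows "ldim (Q n 1 (n div 2)) \<le>
    real n / (log 2 (real n) - 2 * log 2 (log 2 (real n)) - 1) + real n / (log 2 (real n))\<^sup>2 + 3"
proof -
  define l where "l = log 2 (real n)"
  define x where "x = l - 2 * log 2 l"
  define b where "b = nat \<lfloor>x\<rfloor>"
  have x: "x > 1" using pos by (simp add: x_def l_def)
  have l: "l > 0" using assms by (simp add: l_def)
  have b: "b \<ge> 1" "real b \<le> x" "x - 1 < real b" using x unfolding b_def by linarith+
  have "ldim (Q n 1 (n div 2)) \<le> n div b + 2 ^ b + 3"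
    using ldim_upper[of "n div 2" n b] assms b by simp
  then have "real (ldim (Q n 1 (n div 2))) \<le> real (n div b + 2 ^ b + 3)"
    by (simp only: of_nat_le_iff)
  also have "\<dots> = real (n div b) + 2 ^ b + 3" by simp
  also have "real (n div b) \<le> real n / real b" by (simp add: of_nat_div_le_of_nat)
  also have "\<dots> \<le> real n / (x - 1)" using b x by (intro divide_left_mono) auto
  also have "(2::real) ^ b = 2 powr real b" by (simp add: powr_realpow)
  also have "\<dots> \<le> 2 powr x" using b by simp
  also have "\<dots> = real n / l\<^sup>2"
  proof -
    have "2 powr x = 2 powr l / (2 powr log 2 l) ^ 2"
      by (simp add: x_def powr_diff powr_power mult.commute)
    then show ?thesis using l assms by (simp add: l_def)
  qed
  finally show ?thesis by (simp add: x_def l_def)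
qed

theorem theorem1:
  shows "(\<lambda>n::nat. real (ldim (Q n 1 (n div 2))) - real n / log 2 (real n))
           \<in> O(\<lambda>n. real n * log 2 (log 2 (real n)) / (log 2 (real n))\<^sup>2)"
proof -
  define g where "g = (\<lambda>n::nat. real n * log 2 (log 2 (real n)) / (log 2 (real n))\<^sup>2)"
  define lo where "lo = (\<lambda>n::nat. (real n - log 2 (real n + 1)) / (log 2 (real n) + log 2 (exp 1))
    - real n / log 2 (real n))"
  define hi where "hi = (\<lambda>n::nat. real n / (log 2 (real n) - 2 * log 2 (log 2 (real n)) - 1)
    + real n / (log 2 (real n))\<^sup>2 + 3 - real n / log 2 (real n))"
  \<comment> \<open>The constant \<open>log 2 (exp 1)\<close> in the denominator costs only order
    \<open>n / (log n)^2\<close>.\<close>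
  have lo: "lo \<in> O(g)" unfolding lo_def g_def by real_asymp
  \<comment> \<open>Here the full error appears: subtracting \<open>2 log log n\<close> in the
    denominator changes the quotient by about \<open>2 n log log n / (log n)^2\<close>.\<close>
  have hi: "hi \<in> O(g)" unfolding hi_def g_def by real_asymp
  have pos: "\<forall>\<^sub>F n::nat in sequentially. log 2 (real n) - 2 * log 2 (log 2 (real n)) - 1 > 0"
    by real_asymp
  \<comment> \<open>A quantity between \<open>lo n\<close> and \<open>hi n\<close> has absolute
    value at most the sum of theirs.\<close>
  have "\<forall>\<^sub>F n in sequentially. norm (real (ldim (Q n 1 (n div 2))) - real n / log 2 (real n))
      \<le> norm (\<bar>lo n\<bar> + \<bar>hi n\<bar>)"
    using pos eventually_ge_at_top[of 4]
  proof eventually_elim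
    case (elim n)
    have "lo n \<le> real (ldim (Q n 1 (n div 2))) - real n / log 2 (real n)"
      "real (ldim (Q n 1 (n div 2))) - real n / log 2 (real n) \<le> hi n"
      using ldim_lower[of n] ldim_upper_log[of n] elim unfolding lo_def hi_def by linarith+
    then show ?case by simp
  qed
  then have "(\<lambda>n. real (ldim (Q n 1 (n div 2))) - real n / log 2 (real n))
      \<in> O(\<lambda>n. \<bar>lo n\<bar> + \<bar>hi n\<bar>)"
    by (rule landau_o.big_mono)
  also have "(\<lambda>n. \<bar>lo n\<bar> + \<bar>hi n\<bar>) \<in> O(g)"
    using lo hi by (intro sum_in_bigo) auto
  finally show ?thesis unfolding g_def .
qed

end
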